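(* Let $-\infty<a<b<\infty$. Consider the equation $${}^{C}D_a^{\alpha_k}x(t)=f\bigl(t,x(t),{}^{C}D_a^{\alpha_1}x(t),{}^{C}D_a^{\alpha_2}x(t),\ldots,{}^{C}D_a^{\alpha_{k-1}}x(t)\bigr),\qquad t\in[a,b],\tag{A}$$ subject to the initial conditions $$(D^jx)(a)=x_a^{(j)},\qquad j=0,1,\ldots,\lceil\alpha_k\rceil-1,\tag{B}$$ with given real numbers $x_a^{(j)}$, where $\alpha_k>\alpha_{k-1}>\cdots>\alpha_1>0$, $\alpha_j-\alpha_{j-1}\le 1$ for all $j=2,3,\ldots,k$, $0<\alpha_1\le 1$, and $f:[a,b]\times\mathbb{R}^k\to\mathbb{R}$ is a continuous function. Assume that $\alpha_j\in\mathbb{Q}$ for all $j=1,\ldots,k$, define $M$ to be the least common multiple of the denominators of $\alpha_1,\ldots,\alpha_k$, and set $\gamma=1/M$ and $N=M\alpha_k$. Then this initial value problem is equivalent to the system of equations $$\begin{array}{rcl}{}^{C}D_a^{\gamma}x_0(t)&=&x_1(t),\\ {}^{C}D_a^{\gamma}x_1(t)&=&x_2(t),\\ &\vdots&\\ {}^{C}D_a^{\gamma}x_{N-2}(t)&=&x_{N-1}(t),\\ {}^{C}D_a^{\gamma}x_{N-1}(t)&=&f\bigl(t,x_0(t),x_{\alpha_1/\gamma}(t),\ldots,x_{\alpha_{k-1}/\gamma}(t)\bigr),\end{array}\tag{C}$$ together with the initial conditions, for $j=0,1,\ldots,N-1$, $$x_j(a)=\begin{cases}x_a^{(j/M)},&\text{if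 } j/M\in\mathbb{N},\\ 0,&\text{if } j/M\notin\mathbb{N},\end{cases}\tag{D}$$ in the following sense. 1. Whenever the vector function $X:=(x_0,x_1,\ldots,x_{N-1})^T$ is a solution of the system (C)-(D), the function $x:=x_0$ solves the initial value problem (A)-(B) on $[a,b]$. 2. Whenever the function $x\in C^{\lceil\alpha_k\rceil-1}[a,b]$ is a solution of the initial value problem (A)-(B), the vector function $$X:=(x_0,x_1,\ldots,x_{N-1})^T:=(x,{}^{C}D_a^{\gamma}x,{}^{C}D_a^{2\gamma}x,\ldots,{}^{C}D_a^{(N-1)\gamma}x)^T$$ solves the multidimensional initial value problem (C)-(D).
   Context: $\mathbb{N}=\{0,1,2,\ldots\}$; denominators of rationals are taken in lowest terms. For $\alpha>0$, $J_a^\alpha f(x):=\frac{1}{\Gamma(\alpha)}\int_a^x (x-t)^{\alpha-1}f(t)\,dt$ for $a\le x\le b$; $J_a^0$ is the identity. $D^m$ denotes the ordinary derivative of integer order $m$. For $\alpha>0$ and $m:=\lceil\alpha\rceil$ put ${}^{RL}D_a^{\alpha}f:=D^mJ_a^{m-\alpha}f$. For $\alpha>0$, $m:=\lceil\alpha\rceil$ and $f\in C^{m-1}[a,b]$, the Caputo fractional derivative of order $\alpha$ is ${}^{C}D_a^{\alpha}f:={}^{RL}D_a^{\alpha}(f-T_{m-1}[f;a])$, where $T_{m-1}[f;a](t):=\sum_{k=0}^{m-1}\frac{(D^kf)(a)}{k!}(t-a)^k$; ${}^{C}D_a^0$ is the identity. A function $f\in C^{m-1}[a,b]$ is called continuously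 Caputo $\alpha$-differentiable if ${}^{C}D_a^{\alpha}f$ exists and belongs to $C[a,b]$. A solution of a Caputo fractional differential equation is a function that is continuously Caputo differentiable of the order of the equation and satisfies the equation; so a solution of (A) is a continuously Caputo $\alpha_k$-differentiable function $x:[a,b]\to\mathbb{R}$ satisfying (A), and a solution of (C) is a vector function each of whose components is continuously Caputo $\gamma$-differentiable and which satisfies (C). *)

theory Defs
  imports "HOL-Analysis.Analysis"
begin

text \<open>
  Functions on \<open>[a,b]\<close> are represented by total functions on \<^typ>\<open>real\<close>, of which only the
  values on \<open>[a,b]\<close> matter. Derivatives are taken within \<open>[a,b]\<close>, hence are one-sided at the
  end points. The value of \<open>nderiv a b m f\<close> is meaningful only if \<open>n_differentiable a b m f\<close>.
\<close>

definition nderiv :: "real \<Rightarrow> real \<Rightarrow> nat \<Rightarrow> (real \<Rightarrow> real) \<Rightarrow> real \<Rightarrow> real" where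
  "nderiv a b m f = ((\<lambda>g x. vector_derivative g (at x within {a..b})) ^^ m) f"

definition n_differentiable :: "real \<Rightarrow> real \<Rightarrow> nat \<Rightarrow> (real \<Rightarrow> real) \<Rightarrow> bool" where
  "n_differentiable a b m f \<longleftrightarrow> (\<forall>i<m. nderiv a b i f differentiable_on {a..b})"

definition C_class :: "real \<Rightarrow> real \<Rightarrow> nat \<Rightarrow> (real \<Rightarrow> real) \<Rightarrow> bool" where
  "C_class a b m f \<longleftrightarrow> n_differentiable a b m f \<and> continuous_on {a..b} (nderiv a b m f)"

definition rl_integral :: "real \<Rightarrow> real \<Rightarrow> (real \<Rightarrow> real) \<Rightarrow> real \<Rightarrow> real" where
  "rl_integral a \<alpha> f =
     (if \<alpha> = 0 then f
      else (\<lambda>x. 1 / Gamma \<alpha> * integral {a..x} (\<lambda>t. (x - t) powr (\<alpha> - 1) * f t)))"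

definition rl_deriv :: "real \<Rightarrow> real \<Rightarrow> real \<Rightarrow> (real \<Rightarrow> real) \<Rightarrow> real \<Rightarrow> real" where
  "rl_deriv a b \<alpha> f = (let m = nat \<lceil>\<alpha>\<rceil> in nderiv a b m (rl_integral a (real m - \<alpha>) f))"

definition rl_differentiable :: "real \<Rightarrow> real \<Rightarrow> real \<Rightarrow> (real \<Rightarrow> real) \<Rightarrow> bool" where
  "rl_differentiable a b \<alpha> f \<longleftrightarrow>
     (let m = nat \<lceil>\<alpha>\<rceil> in n_differentiable a b m (rl_integral a (real m - \<alpha>) f))"

definition taylor_poly :: "real \<Rightarrow> real \<Rightarrow> nat \<Rightarrow> (real \<Rightarrow> real) \<Rightarrow> real \<Rightarrow> real" where
  "taylor_poly a b n f t = (\<Sum>i\<le>n. nderiv a b i f a / fact i * (t - a) ^ i)"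

definition caputo_deriv :: "real \<Rightarrow> real \<Rightarrow> real \<Rightarrow> (real \<Rightarrow> real) \<Rightarrow> real \<Rightarrow> real" where
  "caputo_deriv a b \<alpha> f =
     (if \<alpha> = 0 then f
      else rl_deriv a b \<alpha> (\<lambda>t. f t - taylor_poly a b (nat \<lceil>\<alpha>\<rceil> - 1) f t))"

definition caputo_differentiable :: "real \<Rightarrow> real \<Rightarrow> real \<Rightarrow> (real \<Rightarrow> real) \<Rightarrow> bool" where
  "caputo_differentiable a b \<alpha> f \<longleftrightarrow>
     \<alpha> = 0 \<or>
     C_class a b (nat \<lceil>\<alpha>\<rceil> - 1) f \<and>
     rl_differentiable a b \<alpha> (\<lambda>t. f t - taylor_poly a b (nat \<lceil>\<alpha>\<rceil> - 1) f t)"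

definition cont_caputo_differentiable :: "real \<Rightarrow> real \<Rightarrow> real \<Rightarrow> (real \<Rightarrow> real) \<Rightarrow> bool" where
  "cont_caputo_differentiable a b \<alpha> f \<longleftrightarrow>
     caputo_differentiable a b \<alpha> f \<and> continuous_on {a..b} (caputo_deriv a b \<alpha> f)"

definition denominator :: "real \<Rightarrow> nat" where
  "denominator r = nat (snd (quotient_of (THE q. real_of_rat q = r)))"

text \<open>
  The next fact shows that the floors used to turn the real numbers \<open>M \<alpha>\<^sub>k\<close> and
  \<open>\<alpha>\<^sub>i / \<gamma> = \<alpha>\<^sub>i M\<close> into natural numbers are exact.
\<close>

lemma denominator_pos_mult_in_Ints:
  assumes "r \<in> \<rat>"
  shows "denominator r > 0" "real (denominator r) * r \<in> \<int>"
proof -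
  obtain q where q: "r = real_of_rat q"
    using assms by (auto elim: Rats_cases)
  obtain n d where nd: "quotient_of q = (n, d)"
    by (cases "quotient_of q")
  have d: "d > 0"
    using nd by (rule quotient_of_denom_pos)
  have "(THE q'. real_of_rat q' = r) = q"
    by (rule the_equality) (auto simp: q)
  then have den: "denominator r = nat d"
    by (simp add: denominator_def nd)
  show "denominator r > 0"
    using d den by simp
  have "q = of_int n / of_int d"
    using nd by (rule quotient_of_div)
  then have "r = of_int n / of_int d"
    by (simp add: q of_rat_divide)
  then have "real (denominator r) * r = of_int n"
    using d den by simp
  then show "real (denominator r) * r \<in> \<int>"
    by simp
qed

lemma nat_floor_Lcm_denominator_mult:
  assumes "finite A" "A \<subseteq> \<rat>" "r \<in> A" "r \<ge> 0"
  defines "M \<equiv> Lcm (denominator ` A)"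
  shows "M > 0" "real (nat \<lfloor>real M * r\<rfloor>) = real M * r"
proof -
  have "0 \<notin> denominator ` A"
    using assms(2) denominator_pos_mult_in_Ints(1) by (metis imageE less_irrefl subsetD)
  then have "M \<noteq> 0"
    using assms(1) by (simp add: M_def Lcm_0_iff)
  then show "M > 0"
    by simp
  have "denominator r dvd M"
    using assms(3) by (auto simp: M_def)
  then obtain c where "M = denominator r * c"
    by blast
  then have "real M * r = real c * (real (denominator r) * r)"
    by simp
  moreover have "real (denominator r) * r \<in> \<int>"
    using assms(2,3) denominator_pos_mult_in_Ints(2) by blast
  ultimately have "real M * r \<in> \<int>"
    by (metis Ints_mult Ints_of_nat)
  then show "real (nat \<lfloor>real M * r\<rfloor>) = real M * r"
    using assms(4) by (auto elim!: Ints_cases)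
qed

text \<open>
  The right-hand side \<open>f\<close> takes a pair \<open>(t, v)\<close> with \<open>v\<close> a point of \<^term>\<open>Euclidean_space k\<close>,
  i.e. a sequence \<open>v\<^sub>0, v\<^sub>1, \<dots>\<close> vanishing from index \<open>k\<close> on. In the multi-term equation,
  \<open>v\<^sub>0 = x(t)\<close> and \<open>v\<^sub>i\<close> is the Caputo derivative of order \<open>\<alpha>\<^sub>i\<close> for \<open>1 \<le> i < k\<close>. Satisfying
  the equation includes that these lower-order derivatives exist.
\<close>

definition multi_term_solution ::
  "real \<Rightarrow> real \<Rightarrow> nat \<Rightarrow> (nat \<Rightarrow> real) \<Rightarrow> (real \<times> (nat \<Rightarrow> real) \<Rightarrow> real) \<Rightarrow> (real \<Rightarrow> real) \<Rightarrow> bool"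
  where
  "multi_term_solution a b k \<alpha> f x \<longleftrightarrow>
     cont_caputo_differentiable a b (\<alpha> k) x \<and>
     (\<forall>i\<in>{1..<k}. caputo_differentiable a b (\<alpha> i) x) \<and>
     (\<forall>t\<in>{a..b}. caputo_deriv a b (\<alpha> k) x t =
        f (t, \<lambda>i. if i = 0 then x t else if i < k then caputo_deriv a b (\<alpha> i) x t else 0))"

definition multi_term_initial ::
  "real \<Rightarrow> real \<Rightarrow> nat \<Rightarrow> (nat \<Rightarrow> real) \<Rightarrow> (nat \<Rightarrow> real) \<Rightarrow> (real \<Rightarrow> real) \<Rightarrow> bool" where
  "multi_term_initial a b k \<alpha> xa x \<longleftrightarrow> (\<forall>j<nat \<lceil>\<alpha> k\<rceil>. nderiv a b j x a = xa j)"

definition system_solution ::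
  "real \<Rightarrow> real \<Rightarrow> nat \<Rightarrow> (nat \<Rightarrow> real) \<Rightarrow> (real \<times> (nat \<Rightarrow> real) \<Rightarrow> real) \<Rightarrow> real \<Rightarrow> nat \<Rightarrow>
    (nat \<Rightarrow> real \<Rightarrow> real) \<Rightarrow> bool" where
  "system_solution a b k \<alpha> f \<gamma> N X \<longleftrightarrow>
     (\<forall>j<N. cont_caputo_differentiable a b \<gamma> (X j)) \<and>
     (\<forall>t\<in>{a..b}. \<forall>j. j + 1 < N \<longrightarrow> caputo_deriv a b \<gamma> (X j) t = X (j + 1) t) \<and>
     (\<forall>t\<in>{a..b}. caputo_deriv a b \<gamma> (X (N - 1)) t =
        f (t, \<lambda>i. if i = 0 then X 0 t else if i < k then X (nat \<lfloor>\<alpha> i / \<gamma>\<rfloor>) t else 0))"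

definition system_initial ::
  "real \<Rightarrow> nat \<Rightarrow> nat \<Rightarrow> (nat \<Rightarrow> real) \<Rightarrow> (nat \<Rightarrow> real \<Rightarrow> real) \<Rightarrow> bool" where
  "system_initial a M N xa X \<longleftrightarrow>
     (\<forall>j<N. X j a = (if real j / real M \<in> \<nat> then xa (j div M) else 0))"

end

theory Submission
  imports Defs
begin

text \<open>
  A function is continuously Caputo differentiable of order \<open>\<alpha>\<close> with derivative \<open>g\<close> iff it equals
  a polynomial of degree below \<open>\<lceil>\<alpha>\<rceil>\<close> in \<open>t - a\<close> plus the Riemann--Liouville integral of order
  \<open>\<alpha>\<close> of the continuous function \<open>g\<close>. With the normalised powers
  \<open>e\<^sub>p = (t - a)\<^sup>p / \<Gamma>(p + 1)\<close>, which satisfy \<open>J\<^sup>\<alpha> e\<^sub>p = e\<^sub>\<alpha>\<^sub>+\<^sub>p\<close>, the system unfolds to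
  \<open>x\<^sub>0 = \<Sum>j<p. x\<^sub>j(a) e\<^bsub>j\<gamma>\<^esub> + J\<^bsup>p\<gamma>\<^esup> x\<^sub>p\<close>. The initial conditions leave only the integer
  powers, so this is the representation of a function with Caputo derivative \<open>x\<^sub>p\<close> of order
  \<open>p\<gamma>\<close>; conversely, splitting the representation of \<open>x\<close> for the order \<open>\<alpha>\<^sub>k\<close> produces the
  components of the system. The semigroup law \<open>J\<^sup>\<beta> J\<^sup>\<alpha> = J\<^bsup>\<beta>+\<alpha>\<^esup>\<close> holds on the powers by the
  Beta integral and extends to continuous functions by Weierstrass approximation.
\<close>

section \<open>Riemann--Liouville integrals\<close>

text \<open>
  The case distinction makes the zeroth power equal to 1 also at \<open>t = a\<close>, where
  \<open>0 powr 0 = 0\<close>.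
\<close>

definition frac_power :: "real \<Rightarrow> real \<Rightarrow> real \<Rightarrow> real" where
  "frac_power a p t = (if p = 0 then 1 else (t - a) powr p / Gamma (p + 1))"

lemma frac_power_0 [simp]: "frac_power a 0 t = 1"
  by (simp add: frac_power_def)

lemma frac_power_nonneg: "p \<ge> 0 \<Longrightarrow> frac_power a p t \<ge> 0"
  by (simp add: frac_power_def Gamma_real_nonneg)

lemma frac_power_mono: "p \<ge> 0 \<Longrightarrow> a \<le> s \<Longrightarrow> s \<le> t \<Longrightarrow> frac_power a p s \<le> frac_power a p t"
  by (auto simp: frac_power_def intro!: divide_right_mono powr_mono2 Gamma_real_nonneg)

lemma continuous_on_frac_power: "p \<ge> 0 \<Longrightarrow> continuous_on {a..b} (frac_power a p)"
  unfolding frac_power_def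
  by (cases "p = 0")
    (auto intro!: continuous_intros continuous_on_powr' simp: less_imp_neq[OF Gamma_real_pos, symmetric])

lemma frac_power_nat:
  assumes "t \<ge> a"
  shows "frac_power a (real n) t = (t - a) ^ n / fact n"
  using assms by (cases "t = a") (auto simp: frac_power_def Gamma_fact powr_realpow add.commute)

section \<open>The singular kernel: integrals of powers and integrability\<close>

text \<open>The substitution t = a + d u with d = x - a turns the integral over [a,x] into the Beta
  integral over [0,1]; d scales out with exponent (\<alpha> - 1) + p + 1.\<close>

lemma has_integral_kernel:
  fixes a x \<alpha> p :: real
  assumes "\<alpha> > 0" "p \<ge> 0" "a < x"
  shows "((\<lambda>t. (x - t) powr (\<alpha> - 1) * (t - a) powr p) has_integral
           (x - a) powr (\<alpha> + p) * Beta (p + 1) \<alpha>) {a..x}"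
proof -
  define d where "d = x - a"
  have d: "d > 0"
    using assms by (simp add: d_def)
  have "((\<lambda>t. t powr p * (1 - t) powr (\<alpha> - 1)) has_integral Beta (p + 1) \<alpha>) (cbox 0 1)"
    using has_integral_Beta_real[of "p + 1" \<alpha>] assms by simp
  moreover have "d * (1 + a / d) = x"
    using d by (simp add: d_def field_simps)
  ultimately have "((\<lambda>t. (t / d - a / d) powr p * (1 - (t / d - a / d)) powr (\<alpha> - 1)) has_integral
          d * Beta (p + 1) \<alpha>) {a..x}"
    using has_integral_affinity'[of _ "Beta (p + 1) \<alpha>" 0 1 "1 / d" "- a / d"] d by fastforce
  from has_integral_mult_right[OF this, of "d powr (\<alpha> - 1 + p)"]
  have int: "((\<lambda>t. d powr (\<alpha> - 1 + p) * ((t / d - a / d) powr p * (1 - (t / d - a / d)) powr (\<alpha> - 1)))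
      has_integral d powr (\<alpha> - 1 + p) * (d * Beta (p + 1) \<alpha>)) {a..x}" .
  have "d powr (\<alpha> - 1 + p) * d = d powr (\<alpha> + p)"
    using d powr_add[of d "\<alpha> - 1 + p" 1] by (simp add: algebra_simps)
  moreover have "d powr (\<alpha> - 1 + p) * ((t / d - a / d) powr p * (1 - (t / d - a / d)) powr (\<alpha> - 1))
      = (x - t) powr (\<alpha> - 1) * (t - a) powr p" if "t \<in> {a..x}" for t
  proof -
    have "t / d - a / d = (t - a) / d"
      by (simp add: diff_divide_distrib)
    moreover have "1 - (t - a) / d = (x - t) / d"
      using d by (simp add: d_def field_simps)
    ultimately show ?thesis
      using d that by (simp add: powr_divide powr_add)
  qed
  ultimately show ?thesis
    using has_integral_eq[OF _ int, of "\<lambda>t. (x - t) powr (\<alpha> - 1) * (t - a) powr p"]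
    by (simp add: d_def flip: mult.assoc)
qed

text \<open>Writing the Beta function as a quotient of Gamma values, the normalisation of
  \<open>frac_power\<close> absorbs every constant except \<open>Gamma \<alpha>\<close>, which the
  prefactor of \<open>rl_integral\<close> cancels.\<close>

lemma has_integral_kernel_frac_power:
  assumes "\<alpha> > 0" "p \<ge> 0" "a \<le> x"
  shows "((\<lambda>t. (x - t) powr (\<alpha> - 1) * frac_power a p t) has_integral
           Gamma \<alpha> * frac_power a (\<alpha> + p) x) {a..x}"
proof (cases "a = x")
  case True
  then show ?thesis
    using assms by (simp add: frac_power_def has_integral_refl(2)[of _ x])
next
  case False
  have "((\<lambda>t. (x - t) powr (\<alpha> - 1) * (t - a) powr p / Gamma (p + 1)) has_integral
           (x - a) powr (\<alpha> + p) * Beta (p + 1) \<alpha> / Gamma (p + 1)) {a..x}"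
    using has_integral_kernel[of \<alpha> p a x] False assms by (intro has_integral_divide) auto
  moreover have "(x - a) powr (\<alpha> + p) * Beta (p + 1) \<alpha> / Gamma (p + 1) = Gamma \<alpha> * frac_power a (\<alpha> + p) x"
    using assms less_imp_neq[OF Gamma_real_pos[of "p + 1"]] by (simp add: frac_power_def Beta_def add_ac)
  ultimately have "((\<lambda>t. (x - t) powr (\<alpha> - 1) * (t - a) powr p / Gamma (p + 1)) has_integral
           Gamma \<alpha> * frac_power a (\<alpha> + p) x) {a..x}"
    by simp
  \<comment> \<open>For p = 0 the two integrands disagree at t = a, where \<open>powr\<close> gives
    0 and \<open>frac_power\<close> gives 1; a single point is negligible.\<close>
  then show ?thesis
    by (rule has_integral_spike_finite[rotated 2, where S = "{a}"]) (auto simp: frac_power_def)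
qed

text \<open>The kernel is nonnegative and integrable, hence absolutely integrable; multiplying by
  the bounded measurable function f preserves this.\<close>

lemma integrable_kernel_mult:
  fixes a x \<alpha> :: real and f :: "real \<Rightarrow> real"
  assumes "\<alpha> > 0" "continuous_on {a..x} f"
  shows "(\<lambda>t. (x - t) powr (\<alpha> - 1) * f t) integrable_on {a..x}"
proof (cases "a \<le> x")
  case True
  have "(\<lambda>t. (x - t) powr (\<alpha> - 1)) absolutely_integrable_on {a..x}"
    using has_integral_kernel_frac_power[of \<alpha> 0 a x] assms(1) True
    by (intro nonnegative_absolutely_integrable_1) (auto simp: has_integral_iff)
  moreover have "f \<in> borel_measurable (lebesgue_on {a..x})"
    using assms(2) by (intro continuous_imp_measurable_on_sets_lebesgue) auto
  moreover have "bounded (f ` {a..x})"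
    using assms(2) compact_continuous_image compact_imp_bounded by blast
  ultimately have "(\<lambda>t. f t * (x - t) powr (\<alpha> - 1)) absolutely_integrable_on {a..x}"
    by (intro absolutely_integrable_bounded_measurable_product_real) auto
  then show ?thesis
    by (simp add: mult.commute absolutely_integrable_on_def)
qed auto

section \<open>Elementary rules and a sup-norm bound\<close>

lemma rl_integral_0 [simp]: "rl_integral a 0 f = f"
  by (simp add: rl_integral_def)

text \<open>Because \<open>0 powr 0 = 0\<close>, the kernel of order 1 equals 1 except at t = x,
  which the integral does not see.\<close>

lemma rl_integral_1: "rl_integral a 1 f x = integral {a..x} f"
proof -
  have "integral {a..x} (\<lambda>t. (x - t) powr (1 - 1) * f t) = integral {a..x} f"
    by (rule integral_spike[where S = "{x}"]) auto
  then show ?thesis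
    by (simp add: rl_integral_def)
qed

lemma rl_integral_at_start: "\<alpha> \<noteq> 0 \<Longrightarrow> rl_integral a \<alpha> f a = 0"
  using integral_refl[of a] by (simp add: rl_integral_def)

lemma rl_integral_cong:
  assumes "a \<le> x" "\<And>t. t \<in> {a..x} \<Longrightarrow> f t = g t"
  shows "rl_integral a \<alpha> f x = rl_integral a \<alpha> g x"
proof -
  have "integral {a..x} (\<lambda>t. (x - t) powr (\<alpha> - 1) * f t) = integral {a..x} (\<lambda>t. (x - t) powr (\<alpha> - 1) * g t)"
    using assms(2) by (intro integral_cong) auto
  with assms show ?thesis
    by (simp add: rl_integral_def)
qed

lemma rl_integral_add:
  assumes "\<alpha> \<ge> 0" "continuous_on {a..x} f" "continuous_on {a..x} g"
  shows "rl_integral a \<alpha> (\<lambda>t. f t + g t) x = rl_integral a \<alpha> f x + rl_integral a \<alpha> g x"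
  using assms integrable_kernel_mult[of \<alpha>]
  by (auto simp: rl_integral_def distrib_left integral_add)

lemma rl_integral_cmult: "rl_integral a \<alpha> (\<lambda>t. c * f t) x = c * rl_integral a \<alpha> f x"
  by (simp add: rl_integral_def mult.left_commute)

lemma rl_integral_diff:
  assumes "\<alpha> \<ge> 0" "continuous_on {a..x} f" "continuous_on {a..x} g"
  shows "rl_integral a \<alpha> (\<lambda>t. f t - g t) x = rl_integral a \<alpha> f x - rl_integral a \<alpha> g x"
  using assms integrable_kernel_mult[of \<alpha>]
  by (auto simp: rl_integral_def right_diff_distrib integral_diff)

lemma rl_integral_sum:
  assumes "\<alpha> \<ge> 0" "finite I" "\<And>i. i \<in> I \<Longrightarrow> continuous_on {a..x} (f i)"
  shows "rl_integral a \<alpha> (\<lambda>t. \<Sum>i\<in>I. c i * f i t) x = (\<Sum>i\<in>I. c i * rl_integral a \<alpha> (f i) x)"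
  using assms(2,3)
proof (induction I rule: finite_induct)
  case empty
  then show ?case
    by (auto simp: rl_integral_def)
next
  case (insert i I)
  then show ?case
    using assms(1)
    by (subst sum.insert, simp_all)
      (subst rl_integral_add, auto simp: rl_integral_cmult intro!: continuous_intros)
qed

lemma rl_integral_frac_power:
  assumes "\<alpha> \<ge> 0" "p \<ge> 0" "a \<le> x"
  shows "rl_integral a \<alpha> (frac_power a p) x = frac_power a (\<alpha> + p) x"
proof (cases "\<alpha> = 0")
  case False
  with assms have "Gamma \<alpha> \<noteq> 0"
    by (simp add: Gamma_real_pos less_imp_neq[symmetric])
  then show ?thesis
    using integral_unique[OF has_integral_kernel_frac_power[of \<alpha> p a x]] assms False
    by (simp add: rl_integral_def)
qed auto

text \<open>The bound B comes out of the integral, and what remains is the fractional integral of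
  the constant 1.\<close>

lemma rl_integral_bound:
  assumes "\<alpha> \<ge> 0" "a \<le> x" "continuous_on {a..x} f" "\<And>t. t \<in> {a..x} \<Longrightarrow> \<bar>f t\<bar> \<le> B"
  shows "\<bar>rl_integral a \<alpha> f x\<bar> \<le> frac_power a \<alpha> x * B"
proof (cases "\<alpha> = 0")
  case True
  then show ?thesis
    using assms by simp
next
  case False
  with assms have pos: "\<alpha> > 0"
    by simp
  have "norm (integral {a..x} (\<lambda>t. (x - t) powr (\<alpha> - 1) * f t))
      \<le> integral {a..x} (\<lambda>t. B * ((x - t) powr (\<alpha> - 1) * frac_power a 0 t))"
  proof (intro integral_norm_bound_integral integrable_kernel_mult)
    show "(\<lambda>t. B * ((x - t) powr (\<alpha> - 1) * frac_power a 0 t)) integrable_on {a..x}"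
      using has_integral_mult_right[OF has_integral_kernel_frac_power[of \<alpha> 0 a x]] pos assms
      by (auto simp: has_integral_iff)
  qed (use assms pos in \<open>auto simp: abs_mult mult.commute[of B] intro!: mult_left_mono\<close>)
  also have "\<dots> = B * (Gamma \<alpha> * frac_power a \<alpha> x)"
    using has_integral_mult_right[OF has_integral_kernel_frac_power[of \<alpha> 0 a x]] pos assms
    by (auto simp: has_integral_iff)
  finally show ?thesis
    using pos Gamma_real_pos[of \<alpha>] by (simp add: rl_integral_def field_simps)
qed

section \<open>Weierstrass approximation, continuity and the semigroup law\<close>

text \<open>Weierstrass approximation is applied to f(a + u), so that the polynomial is in powers of
  t - a; the factors \<open>fact i\<close> convert these to normalised powers.\<close>

lemma frac_power_approximation:
  assumes "continuous_on {a..b} f" "e > 0"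
  obtains c n where "\<And>t. t \<in> {a..b} \<Longrightarrow> \<bar>f t - (\<Sum>i\<le>n. c i * frac_power a (real i) t)\<bar> < e"
proof -
  have "continuous_on {0..b - a} (\<lambda>u. f (a + u))"
    by (intro continuous_on_compose2[OF assms(1)] continuous_intros) auto
  then obtain g where g: "real_polynomial_function g" "\<And>u. u \<in> {0..b - a} \<Longrightarrow> \<bar>f (a + u) - g u\<bar> < e"
    using Stone_Weierstrass_real_polynomial_function[of "{0..b - a}" "\<lambda>u. f (a + u)" e] assms(2)
    by blast
  then obtain d n where d: "g = (\<lambda>u. \<Sum>i\<le>n. d i * u ^ i)"
    by (auto simp: real_polynomial_function_iff_sum)
  show ?thesis
  proof
    fix t assume "t \<in> {a..b}"
    with g(2)[of "t - a"]
    show "\<bar>f t - (\<Sum>i\<le>n. (d i * fact i) * frac_power a (real i) t)\<bar> < e"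
      by (simp add: d frac_power_nat)
  qed
qed

lemma continuous_on_uniform_approx:
  fixes f :: "'a::topological_space \<Rightarrow> 'b::metric_space"
  assumes "\<And>e. e > 0 \<Longrightarrow> \<exists>g. continuous_on S g \<and> (\<forall>x\<in>S. dist (g x) (f x) < e)"
  shows "continuous_on S f"
proof -
  have "\<forall>n. \<exists>g. continuous_on S g \<and> (\<forall>x\<in>S. dist (g x) (f x) < inverse (real (Suc n)))"
    using assms by simp
  then obtain g where g: "\<And>n. continuous_on S (g n)"
    "\<And>n x. x \<in> S \<Longrightarrow> dist (g n x) (f x) < inverse (real (Suc n))"
    by metis
  have "uniform_limit S g f sequentially"
    unfolding uniform_limit_iff
  proof safe
    fix e :: real assume "e > 0"
    then have "\<forall>\<^sub>F n in sequentially. inverse (real (Suc n)) < e"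
      using LIMSEQ_inverse_real_of_nat order_tendstoD(2) by blast
    then show "\<forall>\<^sub>F n in sequentially. \<forall>x\<in>S. dist (g n x) (f x) < e"
      by eventually_elim (meson g(2) less_trans)
  qed
  then show ?thesis
    by (rule uniform_limit_theorem[rotated]) (simp_all add: g(1))
qed

text \<open>Both claims are explicit for polynomials in t - a, and \<open>rl_integral_bound\<close>
  transfers them to f, with an error uniform in the point.\<close>

lemma
  assumes "\<alpha> \<ge> 0" "continuous_on {a..b} f"
  shows continuous_on_rl_integral: "continuous_on {a..b} (rl_integral a \<alpha> f)"
    and rl_integral_semigroup: "\<And>\<beta> x. \<beta> \<ge> 0 \<Longrightarrow> x \<in> {a..b} \<Longrightarrow>
      rl_integral a \<beta> (rl_integral a \<alpha> f) x = rl_integral a (\<beta> + \<alpha>) f x"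
proof -
  \<comment> \<open>The polynomial is chosen before the order \<beta>: the semigroup law compares
    fractional integrals of several orders of one and the same polynomial.\<close>
  have approx: "\<exists>c n. let p = (\<lambda>t. \<Sum>i\<le>n. c i * frac_power a (real i) t) in
     \<forall>\<beta>\<ge>0. \<forall>x\<in>{a..b}. \<bar>rl_integral a \<beta> f x - rl_integral a \<beta> p x\<bar> \<le> frac_power a \<beta> b * e"
    if "e > 0" for e
  proof -
    obtain c n where c: "\<And>t. t \<in> {a..b} \<Longrightarrow> \<bar>f t - (\<Sum>i\<le>n. c i * frac_power a (real i) t)\<bar> < e"
      using frac_power_approximation[OF assms(2) \<open>e > 0\<close>] by blast
    define p where "p = (\<lambda>t. \<Sum>i\<le>n. c i * frac_power a (real i) t)"
    have "\<bar>rl_integral a \<beta> f x - rl_integral a \<beta> p x\<bar> \<le> frac_power a \<beta> b * e"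
      if "\<beta> \<ge> 0" "x \<in> {a..b}" for \<beta> x
    proof -
      have f: "continuous_on {a..x} f" and p: "continuous_on {a..x} p"
        using that assms(2) by (auto simp: p_def intro!: continuous_intros continuous_on_frac_power
          elim: continuous_on_subset)
      have "\<bar>rl_integral a \<beta> (\<lambda>t. f t - p t) x\<bar> \<le> frac_power a \<beta> x * e"
        using that f p less_imp_le[OF c]
        by (intro rl_integral_bound) (auto simp: p_def intro!: continuous_intros)
      also have "\<dots> \<le> frac_power a \<beta> b * e"
        using that \<open>e > 0\<close> frac_power_mono[of \<beta> a x b] by auto
      finally show ?thesis
        using that f p by (simp add: rl_integral_diff)
    qed
    then show ?thesis
      unfolding Let_def p_def by blast
  qed
  \<comment> \<open>The shift q = 0 covers the polynomial itself, and q = \<alpha> covers its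
    fractional integral of order \<alpha>.\<close>
  have poly: "rl_integral a \<beta> (\<lambda>t. \<Sum>i\<le>n. c i * frac_power a (q + real i) t) x
      = (\<Sum>i\<le>n. c i * frac_power a (\<beta> + q + real i) x)"
    if "\<beta> \<ge> 0" "q \<ge> 0" "x \<in> {a..b}" for c :: "nat \<Rightarrow> real" and n \<beta> q x
    using that by (simp add: rl_integral_sum continuous_on_frac_power rl_integral_frac_power add.assoc)
  have cont_poly: "continuous_on {a..b} (rl_integral a \<alpha> (\<lambda>t. \<Sum>i\<le>n. c i * frac_power a (real i) t))"
    for c :: "nat \<Rightarrow> real" and n
  proof -
    have "continuous_on {a..b} (\<lambda>x. \<Sum>i\<le>n. c i * frac_power a (\<alpha> + real i) x)"
      using assms(1) by (intro continuous_intros continuous_on_frac_power) auto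
    then show ?thesis
      by (rule continuous_on_eq) (use poly[of \<alpha> 0] assms(1) in simp)
  qed
  show cont: "continuous_on {a..b} (rl_integral a \<alpha> f)"
  proof (cases "a \<le> b")
    case True
    \<comment> \<open>The summand 1 keeps K positive and makes the final error strictly smaller than
      e.\<close>
    define K where "K = frac_power a \<alpha> b + 1"
    have K: "K > 0"
      using frac_power_nonneg[OF assms(1), of a b] by (simp add: K_def)
    show ?thesis
    proof (rule continuous_on_uniform_approx)
      fix e :: real assume "e > 0"
      with K have "e / K > 0"
        by simp
      from approx[OF this] obtain c n where cn: "let p = (\<lambda>t. \<Sum>i\<le>n. c i * frac_power a (real i) t) in
          \<forall>\<beta>\<ge>0. \<forall>x\<in>{a..b}. \<bar>rl_integral a \<beta> f x - rl_integral a \<beta> p x\<bar> \<le> frac_power a \<beta> b * (e / K)"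
        by blast
      have c: "\<bar>rl_integral a \<alpha> f x - rl_integral a \<alpha> (\<lambda>t. \<Sum>i\<le>n. c i * frac_power a (real i) t) x\<bar>
          \<le> frac_power a \<alpha> b * (e / K)" if "x \<in> {a..b}" for x
        using cn that assms(1) unfolding Let_def by blast
      have "frac_power a \<alpha> b * (e / K) < e"
        using \<open>e > 0\<close> K by (simp add: field_simps K_def)
      then have "dist (rl_integral a \<alpha> (\<lambda>t. \<Sum>i\<le>n. c i * frac_power a (real i) t) x)
          (rl_integral a \<alpha> f x) < e" if "x \<in> {a..b}" for x
        using c[OF that] unfolding dist_real_def by linarith
      then show "\<exists>g. continuous_on {a..b} g \<and> (\<forall>x\<in>{a..b}. dist (g x) (rl_integral a \<alpha> f x) < e)"
        using cont_poly[of c n] by blast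
    qed
  qed auto
  show "rl_integral a \<beta> (rl_integral a \<alpha> f) x = rl_integral a (\<beta> + \<alpha>) f x"
    if "\<beta> \<ge> 0" "x \<in> {a..b}" for \<beta> x
  proof -
    \<comment> \<open>Triangle inequality: the first term bounds the order \<beta> integral of the
      error made at order \<alpha>, the second the error made directly at order \<beta> +
      \<alpha>.\<close>
    define K where "K = frac_power a \<beta> x * frac_power a \<alpha> b + frac_power a (\<beta> + \<alpha>) b"
    have "\<bar>rl_integral a \<beta> (rl_integral a \<alpha> f) x - rl_integral a (\<beta> + \<alpha>) f x\<bar> \<le> K * e" if "e > 0" for e
    proof -
      obtain c n where cn: "let p = (\<lambda>t. \<Sum>i\<le>n. c i * frac_power a (real i) t) in \<forall>\<beta>\<ge>0. \<forall>x\<in>{a..b}.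
          \<bar>rl_integral a \<beta> f x - rl_integral a \<beta> p x\<bar> \<le> frac_power a \<beta> b * e"
        using approx[OF \<open>e > 0\<close>] by blast
      define p where "p = (\<lambda>t. \<Sum>i\<le>n. c i * frac_power a (real i) t)"
      have p: "\<bar>rl_integral a \<beta> f x - rl_integral a \<beta> p x\<bar> \<le> frac_power a \<beta> b * e"
        if "\<beta> \<ge> 0" "x \<in> {a..b}" for \<beta> x
        using cn that by (simp add: Let_def p_def)
      have sub: "{a..x} \<subseteq> {a..b}"
        using \<open>x \<in> {a..b}\<close> by auto
      have cp: "continuous_on {a..x} (rl_integral a \<alpha> p)" and cf: "continuous_on {a..x} (rl_integral a \<alpha> f)"
        using cont_poly cont continuous_on_subset[OF _ sub] unfolding p_def by blast+
      have "rl_integral a \<beta> (rl_integral a \<alpha> p) x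
          = rl_integral a \<beta> (\<lambda>t. \<Sum>i\<le>n. c i * frac_power a (\<alpha> + real i) t) x"
      proof (rule rl_integral_cong)
        fix t assume "t \<in> {a..x}"
        then show "rl_integral a \<alpha> p t = (\<Sum>i\<le>n. c i * frac_power a (\<alpha> + real i) t)"
          using poly[of \<alpha> 0 t c n] assms(1) \<open>x \<in> {a..b}\<close> by (simp add: p_def)
      qed (use \<open>x \<in> {a..b}\<close> in auto)
      also have "\<dots> = (\<Sum>i\<le>n. c i * frac_power a (\<beta> + \<alpha> + real i) x)"
        using poly[of \<beta> \<alpha>] assms(1) \<open>x \<in> {a..b}\<close> \<open>\<beta> \<ge> 0\<close> by simp
      also have "\<dots> = rl_integral a (\<beta> + \<alpha>) p x"
        using poly[of "\<beta> + \<alpha>" 0] assms(1) \<open>x \<in> {a..b}\<close> \<open>\<beta> \<ge> 0\<close> by (simp add: p_def)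
      finally have eq: "rl_integral a \<beta> (rl_integral a \<alpha> p) x = rl_integral a (\<beta> + \<alpha>) p x" .
      have "\<bar>rl_integral a \<beta> (\<lambda>t. rl_integral a \<alpha> f t - rl_integral a \<alpha> p t) x\<bar>
          \<le> frac_power a \<beta> x * (frac_power a \<alpha> b * e)"
        using p assms(1) \<open>x \<in> {a..b}\<close> \<open>\<beta> \<ge> 0\<close> cp cf
        by (intro rl_integral_bound) (auto intro!: continuous_intros)
      then have "\<bar>rl_integral a \<beta> (rl_integral a \<alpha> f) x - rl_integral a \<beta> (rl_integral a \<alpha> p) x\<bar>
          \<le> frac_power a \<beta> x * (frac_power a \<alpha> b * e)"
        using cp cf \<open>\<beta> \<ge> 0\<close> by (simp add: rl_integral_diff)
      moreover have "\<bar>rl_integral a (\<beta> + \<alpha>) f x - rl_integral a (\<beta> + \<alpha>) p x\<bar> \<le> frac_power a (\<beta> + \<alpha>) b * e"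
        using p assms(1) \<open>x \<in> {a..b}\<close> \<open>\<beta> \<ge> 0\<close> by simp
      ultimately show ?thesis
        unfolding eq K_def by (simp add: distrib_right)
    qed
    \<comment> \<open>The left side does not depend on e, so letting e tend to 0 from the right
      makes it vanish.\<close>
    then have bound: "\<forall>\<^sub>F e in at_right 0.
        \<bar>rl_integral a \<beta> (rl_integral a \<alpha> f) x - rl_integral a (\<beta> + \<alpha>) f x\<bar> \<le> K * e"
      by (auto simp: eventually_at_filter)
    have "((\<lambda>e. K * e) \<longlongrightarrow> K * 0) (at_right 0)"
      by (intro tendsto_intros)
    from tendsto_lowerbound[OF this bound]
    have "\<bar>rl_integral a \<beta> (rl_integral a \<alpha> f) x - rl_integral a (\<beta> + \<alpha>) f x\<bar> \<le> 0"
      by simp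
    then show ?thesis
      by simp
  qed
qed

section \<open>Fractional power expansions and injectivity of the integral\<close>

lemma continuous_on_expansion:
  assumes "\<And>i. i \<in> I \<Longrightarrow> p i \<ge> 0" "\<beta> \<ge> 0" "continuous_on {a..b} u"
  shows "continuous_on {a..b} (\<lambda>t. (\<Sum>i\<in>I. c i * frac_power a (p i) t) + rl_integral a \<beta> u t)"
  using assms by (intro continuous_intros continuous_on_frac_power continuous_on_rl_integral) auto

text \<open>Linearity, the rule for powers and the semigroup law together: integrating to order
  \<alpha> adds \<alpha> to every exponent and to the order of the remainder. All later index shifts
  are instances of this.\<close>

lemma rl_integral_expansion:
  assumes "finite I" "\<And>i. i \<in> I \<Longrightarrow> p i \<ge> 0" "\<alpha> \<ge> 0" "\<beta> \<ge> 0" "continuous_on {a..b} u" "x \<in> {a..b}"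
  shows "rl_integral a \<alpha> (\<lambda>t. (\<Sum>i\<in>I. c i * frac_power a (p i) t) + rl_integral a \<beta> u t) x
      = (\<Sum>i\<in>I. c i * frac_power a (\<alpha> + p i) x) + rl_integral a (\<alpha> + \<beta>) u x"
proof -
  have "{a..x} \<subseteq> {a..b}"
    using assms(6) by auto
  then have "continuous_on {a..x} (rl_integral a \<beta> u)"
    using continuous_on_rl_integral[OF assms(4,5)] continuous_on_subset by blast
  moreover have "continuous_on {a..x} (\<lambda>t. \<Sum>i\<in>I. c i * frac_power a (p i) t)"
    using assms(2) by (intro continuous_intros continuous_on_frac_power)
  ultimately show ?thesis
    using assms
    by (simp add: rl_integral_add rl_integral_sum continuous_on_frac_power rl_integral_frac_power
        rl_integral_semigroup)
qed

lemma has_vector_derivative_rl_integral_1: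
  assumes "continuous_on {a..b} f" "x \<in> {a..b}"
  shows "(rl_integral a 1 f has_vector_derivative f x) (at x within {a..b})"
proof -
  have "rl_integral a 1 f = (\<lambda>x. integral {a..x} f)"
    by (simp add: fun_eq_iff rl_integral_1)
  then show ?thesis
    using integral_has_vector_derivative[OF assms] by simp
qed

text \<open>Applying the integral of order 1 - \<beta> to both sides raises the order to 1, where
  differentiation recovers the integrand.\<close>

lemma rl_integral_inject:
  assumes "a < b" "0 \<le> \<beta>" "\<beta> \<le> 1" "continuous_on {a..b} f" "continuous_on {a..b} g"
    and eq: "\<And>t. t \<in> {a..b} \<Longrightarrow> rl_integral a \<beta> f t = rl_integral a \<beta> g t"
    and "x \<in> {a..b}"
  shows "f x = g x"
proof -
  have "rl_integral a 1 f t = rl_integral a 1 g t" if "t \<in> {a..b}" for t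
  proof -
    have "rl_integral a (1 - \<beta>) (rl_integral a \<beta> f) t = rl_integral a (1 - \<beta>) (rl_integral a \<beta> g) t"
      by (rule rl_integral_cong) (use that eq in auto)
    then show ?thesis
      using assms that rl_integral_semigroup[of \<beta> a b _ "1 - \<beta>"] by simp
  qed
  then have "(rl_integral a 1 f has_vector_derivative g x) (at x within {a..b})"
    using assms(7)
    by (intro has_vector_derivative_transform[OF _ _ has_vector_derivative_rl_integral_1[OF assms(5,7)]]) auto
  then show ?thesis
    using has_vector_derivative_rl_integral_1[OF assms(4,7)] assms(1,7)
      vector_derivative_unique_within_closed_interval[of a b x "rl_integral a 1 f" "f x" "g x"] by simp
qed

section \<open>Iterated derivatives on an interval\<close>

lemma nderiv_0 [simp]: "nderiv a b 0 f = f"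
  by (simp add: nderiv_def)

lemma nderiv_Suc: "nderiv a b (Suc m) f = (\<lambda>x. vector_derivative (nderiv a b m f) (at x within {a..b}))"
  by (simp add: nderiv_def)

lemma nderiv_Suc_shift: "nderiv a b (Suc m) f = nderiv a b m (nderiv a b (Suc 0) f)"
  by (simp add: nderiv_def funpow_Suc_right del: funpow.simps)

lemma n_differentiable_Suc:
  "n_differentiable a b (Suc m) f \<longleftrightarrow>
     f differentiable_on {a..b} \<and> n_differentiable a b m (nderiv a b (Suc 0) f)"
  by (simp add: n_differentiable_def All_less_Suc2 flip: nderiv_Suc_shift)

text \<open>Induction on n: taking one ordinary integral out of the expansion leaves f = c 0 + J^1
  g, where g = f' is an expansion of length n with shifted coefficients.\<close>

lemma taylor_expansion_imp:
  assumes "a < b" "continuous_on {a..b} u"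
    and "\<And>t. t \<in> {a..b} \<Longrightarrow>
      f t = (\<Sum>i<n. c i * frac_power a (real i) t) + rl_integral a (real n) u t"
  shows "n_differentiable a b n f \<and> (\<forall>t\<in>{a..b}. nderiv a b n f t = u t) \<and>
      (\<forall>i<n. nderiv a b i f a = c i)"
  using assms(3)
proof (induction n arbitrary: f c)
  case 0
  then show ?case
    by (simp add: n_differentiable_def)
next
  case (Suc n)
  define g where
    "g t = (\<Sum>i<n. c (Suc i) * frac_power a (real i) t) + rl_integral a (real n) u t" for t
  have cont: "continuous_on {a..b} g"
    unfolding g_def using assms(2) by (intro continuous_on_expansion) auto
  have f: "f t = c 0 + rl_integral a 1 g t" if "t \<in> {a..b}" for t
    unfolding g_def Suc.prems[OF that] using that assms(2)
    by (subst rl_integral_expansion[where b = b])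
      (auto simp: sum.lessThan_Suc_shift add.commute[of _ 1] simp del: sum.lessThan_Suc)
  have deriv: "(f has_vector_derivative g t) (at t within {a..b})" if "t \<in> {a..b}" for t
  proof -
    have "((\<lambda>t. c 0 + rl_integral a 1 g t) has_vector_derivative g t) (at t within {a..b})"
      using has_vector_derivative_add[OF has_vector_derivative_const
          has_vector_derivative_rl_integral_1[OF cont that]] by simp
    from has_vector_derivative_transform[OF that f this] show ?thesis .
  qed
  \<comment> \<open>Agreement on [a,b] suffices, since the induction hypothesis only asks for the
    values there.\<close>
  then have "nderiv a b (Suc 0) f t = g t" if "t \<in> {a..b}" for t
    using that assms(1) vector_derivative_within_cbox[of a b t f "g t"] by (simp add: nderiv_Suc)
  then have IH: "n_differentiable a b n (nderiv a b (Suc 0) f) \<and>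
      (\<forall>t\<in>{a..b}. nderiv a b n (nderiv a b (Suc 0) f) t = u t) \<and>
      (\<forall>i<n. nderiv a b i (nderiv a b (Suc 0) f) a = c (Suc i))"
    by (intro Suc.IH) (simp add: g_def)
  moreover have "f differentiable_on {a..b}"
    unfolding differentiable_on_def using differentiableI_vector[OF deriv] by blast
  moreover have "f a = c 0"
    using f[of a] assms(1) by (simp add: rl_integral_at_start)
  ultimately have "n_differentiable a b (Suc n) f" "\<forall>t\<in>{a..b}. nderiv a b (Suc n) f t = u t"
    and "\<forall>i<Suc n. nderiv a b i f a = c i"
    unfolding n_differentiable_Suc All_less_Suc2 nderiv_0
    by (simp_all flip: nderiv_Suc_shift)
  then show ?case
    by blast
qed

text \<open>Converse of \<open>taylor_expansion_imp\<close>: expand f' by induction, then integrate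
  once from a to t with the fundamental theorem of calculus.\<close>

lemma taylor_expansion:
  assumes "a < b" "n_differentiable a b n f" "continuous_on {a..b} (nderiv a b n f)" "t \<in> {a..b}"
  shows "f t = (\<Sum>i<n. nderiv a b i f a * frac_power a (real i) t)
      + rl_integral a (real n) (nderiv a b n f) t"
  using assms(2-)
proof (induction n arbitrary: f t)
  case (Suc n)
  define g where "g t = (\<Sum>i<n. nderiv a b (Suc i) f a * frac_power a (real i) t)
      + rl_integral a (real n) (nderiv a b (Suc n) f) t" for t
  have g: "nderiv a b (Suc 0) f t = g t" if "t \<in> {a..b}" for t
    using Suc.IH[of "nderiv a b (Suc 0) f" t] Suc.prems(1,2) that
    by (simp add: n_differentiable_Suc g_def flip: nderiv_Suc_shift)
  have "(f has_vector_derivative g s) (at s within {a..t})" if "s \<in> {a..t}" for s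
  proof -
    have "s \<in> {a..b}" and sub: "{a..t} \<subseteq> {a..b}"
      using that Suc.prems(3) by auto
    have "(f has_vector_derivative nderiv a b (Suc 0) f s) (at s within {a..b})"
      using Suc.prems(1) \<open>s \<in> {a..b}\<close>
      by (simp add: n_differentiable_Suc nderiv_Suc differentiable_on_def vector_derivative_works)
    from has_vector_derivative_within_subset[OF this sub] show ?thesis
      unfolding g[OF \<open>s \<in> {a..b}\<close>] .
  qed
  then have "(g has_integral f t - f a) {a..t}"
    using Suc.prems(3) by (intro fundamental_theorem_of_calculus) auto
  then have "f t = f a + rl_integral a 1 g t"
    by (simp add: rl_integral_1 integral_unique)
  also have "rl_integral a 1 g t = (\<Sum>i<n. nderiv a b (Suc i) f a * frac_power a (real (Suc i)) t)
      + rl_integral a (real (Suc n)) (nderiv a b (Suc n) f) t"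
    unfolding g_def using Suc.prems(2,3) by (subst rl_integral_expansion[where b = b]) auto
  finally show ?case
    by (simp add: sum.lessThan_Suc_shift del: sum.lessThan_Suc)
qed auto

section \<open>Caputo derivatives\<close>

lemma taylor_poly_frac_power:
  assumes "t \<ge> a"
  shows "taylor_poly a b n f t = (\<Sum>i<Suc n. nderiv a b i f a * frac_power a (real i) t)"
  using assms by (simp add: taylor_poly_def frac_power_nat lessThan_Suc_atMost)

text \<open>With n + 1 the ceiling of \<alpha>, the Taylor polynomial of f is exactly the given sum,
  so subtracting it leaves J^\<alpha> g. Its integral of order n + 1 - \<alpha> is J^(n+1) g, whose
  derivative of order n + 1 is g.\<close>

lemma cont_caputo_differentiable_if_expansion:
  assumes "a < b" "\<alpha> > 0" "continuous_on {a..b} g"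
    and f: "\<And>t. t \<in> {a..b} \<Longrightarrow>
      f t = (\<Sum>i<nat \<lceil>\<alpha>\<rceil>. c i * frac_power a (real i) t) + rl_integral a \<alpha> g t"
  shows "cont_caputo_differentiable a b \<alpha> f"
    and "\<And>t. t \<in> {a..b} \<Longrightarrow> caputo_deriv a b \<alpha> f t = g t"
    and "\<And>i. i < nat \<lceil>\<alpha>\<rceil> \<Longrightarrow> nderiv a b i f a = c i"
proof -
  obtain n where n: "nat \<lceil>\<alpha>\<rceil> = Suc n"
    using assms(2) by (metis gr0_implies_Suc zero_less_ceiling zero_less_nat_eq)
  then have n_less: "real n < \<alpha>" and n_ge: "\<alpha> \<le> real (Suc n)"
    using assms(2) by linarith+
  \<comment> \<open>This will be the n-th derivative of f: the top power has become the constant c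
    n, and n < \<alpha> leaves an integral of positive order, which vanishes at a.\<close>
  define u where "u t = (\<Sum>i\<in>{n}. c i * frac_power a 0 t) + rl_integral a (\<alpha> - real n) g t" for t
  have cont_u: "continuous_on {a..b} u"
    unfolding u_def using assms(3) n_less by (intro continuous_on_expansion) auto
  have "f t = (\<Sum>i<n. c i * frac_power a (real i) t) + rl_integral a (real n) u t" if "t \<in> {a..b}" for t
  proof -
    have "rl_integral a (real n) u t = c n * frac_power a (real n) t + rl_integral a \<alpha> g t"
      unfolding u_def using that assms(3) n_less by (subst rl_integral_expansion[where b = b]) auto
    then show ?thesis
      using f[OF that] by (simp add: n)
  qed
  from taylor_expansion_imp[OF assms(1) cont_u this]
  have diff: "n_differentiable a b n f" and u: "\<And>t. t \<in> {a..b} \<Longrightarrow> nderiv a b n f t = u t"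
    and c: "\<And>i. i < n \<Longrightarrow> nderiv a b i f a = c i"
    by auto
  have "nderiv a b n f a = c n"
    using u[of a] assms(1) n_less by (simp add: u_def rl_integral_at_start)
  with c show c': "nderiv a b i f a = c i" if "i < nat \<lceil>\<alpha>\<rceil>" for i
    using that n less_Suc_eq by auto
  have "C_class a b n f"
    using diff continuous_on_eq[OF cont_u] u by (simp add: C_class_def)
  define h where "h t = f t - taylor_poly a b n f t" for t
  have h: "h t = rl_integral a \<alpha> g t" if "t \<in> {a..b}" for t
    using that f[OF that] c' by (simp add: h_def taylor_poly_frac_power n)
  \<comment> \<open>The zero coefficients bring J^(n+1) g into the form that
    \<open>taylor_expansion_imp\<close> expects.\<close>
  have "rl_integral a (real (Suc n) - \<alpha>) h t
      = (\<Sum>i<Suc n. 0 * frac_power a (real i) t) + rl_integral a (real (Suc n)) g t" if "t \<in> {a..b}" for t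
  proof -
    have "rl_integral a (real (Suc n) - \<alpha>) h t = rl_integral a (real (Suc n) - \<alpha>) (rl_integral a \<alpha> g) t"
      using that h by (intro rl_integral_cong) auto
    then show ?thesis
      using that assms(2,3) n_ge by (simp add: rl_integral_semigroup)
  qed
  from taylor_expansion_imp[OF assms(1,3) this]
  have diff_h: "n_differentiable a b (Suc n) (rl_integral a (real (Suc n) - \<alpha>) h)"
    and g: "\<And>t. t \<in> {a..b} \<Longrightarrow> nderiv a b (Suc n) (rl_integral a (real (Suc n) - \<alpha>) h) t = g t"
    by auto
  have h_eq: "(\<lambda>t. f t - taylor_poly a b (nat \<lceil>\<alpha>\<rceil> - 1) f t) = h"
    by (simp add: h_def n fun_eq_iff)
  show deriv: "caputo_deriv a b \<alpha> f t = g t" if "t \<in> {a..b}" for t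
    using g[OF that] assms(2) unfolding caputo_deriv_def h_eq by (simp add: rl_deriv_def Let_def n)
  have "caputo_differentiable a b \<alpha> f"
    using diff_h \<open>C_class a b n f\<close> unfolding caputo_differentiable_def h_eq
    by (simp add: rl_differentiable_def Let_def n)
  then show "cont_caputo_differentiable a b \<alpha> f"
    using continuous_on_eq[OF assms(3)] deriv by (simp add: cont_caputo_differentiable_def)
qed

text \<open>Let h be f minus its Taylor polynomial and F its integral of order n + 1 - \<alpha>, so
  that D^(n+1) F = g. Once all derivatives of F up to order n vanish at a, Taylor gives F = J^(n+1)
  g, and injectivity undoes the integral.\<close>

lemma caputo_expansion:
  assumes "a < b" "\<alpha> > 0" "cont_caputo_differentiable a b \<alpha> f" "t \<in> {a..b}"
  shows "f t = (\<Sum>i<nat \<lceil>\<alpha>\<rceil>. nderiv a b i f a * frac_power a (real i) t)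
      + rl_integral a \<alpha> (caputo_deriv a b \<alpha> f) t"
proof -
  obtain n where n: "nat \<lceil>\<alpha>\<rceil> = Suc n"
    using assms(2) by (metis gr0_implies_Suc zero_less_ceiling zero_less_nat_eq)
  then have n_less: "real n < \<alpha>" and n_ge: "\<alpha> \<le> real (Suc n)"
    using assms(2) by linarith+
  define h where "h t = f t - taylor_poly a b n f t" for t
  define g where "g = caputo_deriv a b \<alpha> f"
  define F where "F = rl_integral a (real (Suc n) - \<alpha>) h"
  define u where "u = nderiv a b n f"
  \<comment> \<open>On [a,b] this is the n-th derivative of h; it vanishes at a.\<close>
  define w where "w s = u s - u a" for s
  have h_eq: "(\<lambda>t. f t - taylor_poly a b (nat \<lceil>\<alpha>\<rceil> - 1) f t) = h"
    by (simp add: h_def n fun_eq_iff)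
  have "C_class a b n f" and diff_F: "n_differentiable a b (Suc n) F"
    using assms(2,3) unfolding cont_caputo_differentiable_def caputo_differentiable_def h_eq
    by (simp_all add: rl_differentiable_def Let_def n F_def)
  have g_eq: "g = nderiv a b (Suc n) F"
    using assms(2) unfolding g_def caputo_deriv_def h_eq by (simp add: rl_deriv_def Let_def n F_def)
  have cont_g: "continuous_on {a..b} g"
    using assms(3) by (simp add: cont_caputo_differentiable_def g_def)
  have cont_u: "continuous_on {a..b} u"
    using \<open>C_class a b n f\<close> by (simp add: C_class_def u_def)
  then have cont_w: "continuous_on {a..b} w"
    unfolding w_def by (intro continuous_intros)
  have h: "h s = rl_integral a (real n) w s" if "s \<in> {a..b}" for s
  proof -
    have "u = (\<lambda>t. (\<Sum>i\<in>{n}. u a * frac_power a 0 t) + rl_integral a 0 w t)"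
      by (simp add: fun_eq_iff w_def)
    then have "rl_integral a (real n) u s
        = rl_integral a (real n) (\<lambda>t. (\<Sum>i\<in>{n}. u a * frac_power a 0 t) + rl_integral a 0 w t) s"
      by simp
    also have "\<dots> = u a * frac_power a (real n) s + rl_integral a (real n) w s"
      using that cont_w by (subst rl_integral_expansion[where b = b]) auto
    finally show ?thesis
      using taylor_expansion[of a b n f s] \<open>C_class a b n f\<close> assms(1) that
      by (simp add: h_def taylor_poly_frac_power u_def C_class_def)
  qed
  \<comment> \<open>Commuting the two integrals in F = J^(n+1-\<alpha>) J^n w exhibits v as the n-th
    derivative of F.\<close>
  define v where "v s = rl_integral a (real (Suc n) - \<alpha>) w s" for s
  have cont_v: "continuous_on {a..b} v"
    unfolding v_def using cont_w n_ge by (intro continuous_on_rl_integral) auto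
  have "F s = (\<Sum>i<n. 0 * frac_power a (real i) s) + rl_integral a (real n) v s" if "s \<in> {a..b}" for s
  proof -
    have "F s = rl_integral a (real (Suc n) - \<alpha>) (rl_integral a (real n) w) s"
      unfolding F_def using that h by (intro rl_integral_cong) auto
    also have "\<dots> = rl_integral a (real n) v s"
      unfolding v_def using that n_ge cont_w by (simp add: rl_integral_semigroup add.commute)
    finally show ?thesis
      by simp
  qed
  note F_derivs = taylor_expansion_imp[OF assms(1) cont_v this]
  have "nderiv a b i F a = 0" if "i < Suc n" for i
  proof -
    \<comment> \<open>If \<alpha> = n + 1 the order is 0 and v = w, which is 0 at a by the
      subtraction of u a; otherwise v is an integral of positive order.\<close>
    have "v a = 0"
      by (cases "real (Suc n) = \<alpha>") (simp_all add: v_def w_def rl_integral_at_start)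
    then show ?thesis
      using F_derivs that assms(1) by (auto simp: less_Suc_eq)
  qed
  then have F: "F s = rl_integral a (real (Suc n)) g s" if "s \<in> {a..b}" for s
    using taylor_expansion[of a b "Suc n" F s] assms(1) diff_F cont_g that by (simp flip: g_eq)
  have cont_h: "continuous_on {a..b} h"
    using h continuous_on_eq[OF continuous_on_rl_integral[OF _ cont_w, of "real n"]] by simp
  \<comment> \<open>Both sides have the same integral of order n + 1 - \<alpha>, and this order lies
    in [0,1).\<close>
  have "h t = rl_integral a \<alpha> g t"
  proof (rule rl_integral_inject[where f = h and \<beta> = "real (Suc n) - \<alpha>"])
    fix s assume "s \<in> {a..b}"
    then show "rl_integral a (real (Suc n) - \<alpha>) h s = rl_integral a (real (Suc n) - \<alpha>) (rl_integral a \<alpha> g) s"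
      using F[of s] assms(2) n_ge cont_g by (simp add: F_def rl_integral_semigroup)
  qed (use assms n_less n_ge cont_h cont_g in \<open>auto intro: continuous_on_rl_integral\<close>)
  then show ?thesis
    using assms(4) by (simp add: h_def taylor_poly_frac_power n g_def)
qed

lemma cont_caputo_differentiable_imp_continuous_on:
  assumes "0 < \<alpha>" "\<alpha> \<le> 1" "cont_caputo_differentiable a b \<alpha> f"
  shows "continuous_on {a..b} f"
proof -
  have "\<lceil>\<alpha>\<rceil> = 1"
    using assms by (simp add: ceiling_eq_iff)
  then show ?thesis
    using assms by (simp add: cont_caputo_differentiable_def caputo_differentiable_def C_class_def)
qed

section \<open>Chains of Caputo derivatives\<close>

lemma less_nat_ceiling_divide_iff:
  assumes "M > 0"
  shows "i < nat \<lceil>real p / real M\<rceil> \<longleftrightarrow> i * M < p"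
proof -
  have "i < nat \<lceil>real p / real M\<rceil> \<longleftrightarrow> real i < real p / real M"
    by (simp add: less_ceiling_iff zless_nat_eq_int_zless)
  also have "\<dots> \<longleftrightarrow> real (i * M) < real p"
    using assms by (simp add: field_simps)
  finally show ?thesis
    by (simp only: of_nat_less_iff)
qed

text \<open>Only j = i M contributes, with exponent j / M = i: initial values supported on multiples
  of M turn a sum of fractional powers into a polynomial.\<close>

lemma sum_over_multiples:
  fixes M :: nat
  assumes "M > 0"
  shows "(\<Sum>j<p. (if M dvd j then c (j div M) else 0) * frac_power a (real j / real M) t)
      = (\<Sum>i<nat \<lceil>real p / real M\<rceil>. c i * frac_power a (real i) t)"
proof -
  have "(\<Sum>j<p. (if M dvd j then c (j div M) else 0) * frac_power a (real j / real M) t)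
      = (\<Sum>j\<in>{j. j < p \<and> M dvd j}. c (j div M) * frac_power a (real j / real M) t)"
    by (rule sum.mono_neutral_cong_right) auto
  also have "\<dots> = (\<Sum>i<nat \<lceil>real p / real M\<rceil>. c i * frac_power a (real i) t)"
    by (rule sum.reindex_bij_witness[where i = "\<lambda>i. i * M" and j = "\<lambda>j. j div M"])
      (use assms in \<open>auto simp: less_nat_ceiling_divide_iff real_of_nat_div\<close>)
  finally show ?thesis .
qed

text \<open>Iteration of the order \<gamma> expansion: substituting Y p = Y p a + J^\<gamma> (Y (Suc
  p)) into the remainder produces one more power and a remainder of order (p + 1) \<gamma>.\<close>

lemma caputo_chain_expansion:
  assumes "a < b" "0 < \<gamma>" "\<gamma> \<le> 1"
    and diff: "\<And>j. j < N \<Longrightarrow> cont_caputo_differentiable a b \<gamma> (Y j)"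
    and deriv: "\<And>j t. j < N \<Longrightarrow> t \<in> {a..b} \<Longrightarrow> caputo_deriv a b \<gamma> (Y j) t = Y (Suc j) t"
    and "p \<le> N" "continuous_on {a..b} (Y N)" "t \<in> {a..b}"
  shows "Y 0 t = (\<Sum>j<p. Y j a * frac_power a (real j * \<gamma>) t) + rl_integral a (real p * \<gamma>) (Y p) t"
  using assms(6,8)
proof (induction p arbitrary: t)
  case (Suc p)
  have cont: "continuous_on {a..b} (Y (Suc p))"
  proof (cases "Suc p = N")
    case False
    with Suc.prems(1) show ?thesis
      by (intro cont_caputo_differentiable_imp_continuous_on[OF assms(2,3) diff]) simp
  qed (use assms(7) in simp)
  have step: "Y p s = (\<Sum>j\<in>{p}. Y j a * frac_power a 0 s) + rl_integral a \<gamma> (Y (Suc p)) s"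
    if "s \<in> {a..b}" for s
  proof -
    have "\<lceil>\<gamma>\<rceil> = 1"
      using assms(2,3) by (simp add: ceiling_eq_iff)
    moreover have "rl_integral a \<gamma> (caputo_deriv a b \<gamma> (Y p)) s = rl_integral a \<gamma> (Y (Suc p)) s"
      by (rule rl_integral_cong) (use that deriv Suc.prems(1) in auto)
    ultimately show ?thesis
      using caputo_expansion[OF assms(1,2) diff that, of p] Suc.prems(1) by simp
  qed
  have "rl_integral a (real p * \<gamma>) (Y p) t
      = rl_integral a (real p * \<gamma>) (\<lambda>s. (\<Sum>j\<in>{p}. Y j a * frac_power a 0 s) + rl_integral a \<gamma> (Y (Suc p)) s) t"
    using Suc.prems(2) by (intro rl_integral_cong step) auto
  also have "\<dots> = Y p a * frac_power a (real p * \<gamma>) t + rl_integral a (real (Suc p) * \<gamma>) (Y (Suc p)) t"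
    using Suc.prems(2) assms(2) cont
    by (subst rl_integral_expansion[where b = b]) (auto simp: algebra_simps)
  finally show ?case
    using Suc.IH[of t] Suc.prems by simp
qed simp

text \<open>The initial values reduce the chain expansion to integer powers below p \<gamma>, which
  is the expansion of a function with Caputo derivative Y p of order p \<gamma>. Each p up to N is
  covered, hence all orders of the equation at once.\<close>

lemma caputo_chain_imp_caputo:
  fixes a b :: real and M N :: nat
  defines "\<gamma> \<equiv> 1 / real M"
  assumes "a < b" "M > 0"
    and diff: "\<And>j. j < N \<Longrightarrow> cont_caputo_differentiable a b \<gamma> (Y j)"
    and deriv: "\<And>j t. j < N \<Longrightarrow> t \<in> {a..b} \<Longrightarrow> caputo_deriv a b \<gamma> (Y j) t = Y (Suc j) t"
    and cont: "continuous_on {a..b} (Y N)"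
    and init: "\<And>j. j < N \<Longrightarrow> Y j a = (if M dvd j then c (j div M) else 0)"
    and "0 < p" "p \<le> N"
  shows "cont_caputo_differentiable a b (real p * \<gamma>) (Y 0)"
    and "\<And>t. t \<in> {a..b} \<Longrightarrow> caputo_deriv a b (real p * \<gamma>) (Y 0) t = Y p t"
    and "\<And>i. i < nat \<lceil>real p * \<gamma>\<rceil> \<Longrightarrow> nderiv a b i (Y 0) a = c i"
proof -
  have \<gamma>: "0 < \<gamma>" "\<gamma> \<le> 1"
    using assms(3) by (auto simp: \<gamma>_def)
  have cont_p: "continuous_on {a..b} (Y p)"
  proof (cases "p = N")
    case False
    with assms(9) show ?thesis
      by (intro cont_caputo_differentiable_imp_continuous_on[OF \<gamma> diff]) simp
  qed (use cont in simp)
  have expansion: "Y 0 t = (\<Sum>i<nat \<lceil>real p * \<gamma>\<rceil>. c i * frac_power a (real i) t)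
      + rl_integral a (real p * \<gamma>) (Y p) t" if "t \<in> {a..b}" for t
  proof -
    have "(\<Sum>j<p. Y j a * frac_power a (real j * \<gamma>) t)
        = (\<Sum>j<p. (if M dvd j then c (j div M) else 0) * frac_power a (real j / real M) t)"
      using init assms(9) by (intro sum.cong) (auto simp: \<gamma>_def)
    also have "\<dots> = (\<Sum>i<nat \<lceil>real p * \<gamma>\<rceil>. c i * frac_power a (real i) t)"
      using sum_over_multiples[OF assms(3)] by (simp add: \<gamma>_def)
    finally show ?thesis
      using caputo_chain_expansion[where Y = Y and N = N, OF assms(2) \<gamma> diff deriv assms(9) cont that] by simp
  qed
  have pos: "0 < real p * \<gamma>"
    using \<gamma> assms(8) by simp
  show "cont_caputo_differentiable a b (real p * \<gamma>) (Y 0)"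
    by (rule cont_caputo_differentiable_if_expansion(1)[OF assms(2) pos cont_p expansion])
  show "caputo_deriv a b (real p * \<gamma>) (Y 0) t = Y p t" if "t \<in> {a..b}" for t
    by (rule cont_caputo_differentiable_if_expansion(2)[OF assms(2) pos cont_p expansion]) (use that in simp_all)
  show "nderiv a b i (Y 0) a = c i" if "i < nat \<lceil>real p * \<gamma>\<rceil>" for i
    by (rule cont_caputo_differentiable_if_expansion(3)[OF assms(2) pos cont_p expansion]) (use that in simp_all)
qed

text \<open>All derivatives of order j \<gamma> are written down explicitly from the single
  expansion of x at order N \<gamma>; consecutive ones then differ by one integral of order \<gamma>
  and a constant.\<close>

lemma caputo_imp_caputo_chain:
  fixes a b :: real and M N :: nat
  defines "\<gamma> \<equiv> 1 / real M"
  assumes "a < b" "M > 0" "N > 0"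
    and x: "cont_caputo_differentiable a b (real N * \<gamma>) x"
    and init: "\<And>i. i < nat \<lceil>real N * \<gamma>\<rceil> \<Longrightarrow> nderiv a b i x a = c i"
  shows "\<And>j. 0 < j \<Longrightarrow> j \<le> N \<Longrightarrow> cont_caputo_differentiable a b (real j * \<gamma>) x"
    and "\<And>j. j < N \<Longrightarrow> cont_caputo_differentiable a b \<gamma> (caputo_deriv a b (real j * \<gamma>) x)"
    and "\<And>j t. j < N \<Longrightarrow> t \<in> {a..b} \<Longrightarrow>
      caputo_deriv a b \<gamma> (caputo_deriv a b (real j * \<gamma>) x) t = caputo_deriv a b (real (Suc j) * \<gamma>) x t"
    and "\<And>j. j < N \<Longrightarrow> caputo_deriv a b (real j * \<gamma>) x a = (if M dvd j then c (j div M) else 0)"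
proof -
  define n where "n = nat \<lceil>real N * \<gamma>\<rceil>"
  define g where "g = caputo_deriv a b (real N * \<gamma>) x"
  \<comment> \<open>These are the integer exponents i with i at least j \<gamma>, whose powers
    survive differentiation of order j \<gamma>; the smaller ones belong to the Taylor
    polynomial.\<close>
  define I where "I j = {i. i < n \<and> j \<le> i * M}" for j
  \<comment> \<open>Candidate for the derivative of order j \<gamma>: every surviving exponent, and
    the order of the remainder, is lowered by j \<gamma>.\<close>
  define Y where "Y j t = (\<Sum>i\<in>I j. c i * frac_power a (real i - real j * \<gamma>) t)
      + rl_integral a (real (N - j) * \<gamma>) g t" for j t
  have \<gamma>: "0 < \<gamma>" "\<gamma> \<le> 1"
    using assms(3) by (auto simp: \<gamma>_def)
  have ceil: "i < nat \<lceil>real j * \<gamma>\<rceil> \<longleftrightarrow> i * M < j" for i j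
    using less_nat_ceiling_divide_iff[OF assms(3), of i j] by (simp add: \<gamma>_def)
  have "\<lceil>\<gamma>\<rceil> = 1"
    using \<gamma> by (simp add: ceiling_eq_iff)
  then have ceil_1: "nat \<lceil>\<gamma>\<rceil> = 1"
    by simp
  have fin: "finite (I j)" for j
    by (simp add: I_def)
  have exponent: "0 \<le> real i - real j * \<gamma>" if "i \<in> I j" for i j
  proof -
    have "real j \<le> real (i * M)"
      using that unfolding I_def by (intro of_nat_mono) auto
    then show ?thesis
      using assms(3) by (simp add: \<gamma>_def field_simps)
  qed
  have cont_g: "continuous_on {a..b} g"
    using x by (simp add: cont_caputo_differentiable_def g_def)
  have cont_Y: "continuous_on {a..b} (Y j)" for j
    unfolding Y_def using \<gamma>(1) cont_g exponent by (intro continuous_on_expansion) auto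
  have rl_Y: "rl_integral a \<beta> (Y j) t = (\<Sum>i\<in>I j. c i * frac_power a (\<beta> + (real i - real j * \<gamma>)) t)
      + rl_integral a (\<beta> + real (N - j) * \<gamma>) g t" if "\<beta> \<ge> 0" "t \<in> {a..b}" for \<beta> j t
    unfolding Y_def using that \<gamma>(1) cont_g exponent fin
    by (subst rl_integral_expansion[where b = b]) auto
  have expansion: "x t = (\<Sum>i<nat \<lceil>real j * \<gamma>\<rceil>. c i * frac_power a (real i) t)
      + rl_integral a (real j * \<gamma>) (Y j) t" if "j \<le> N" "t \<in> {a..b}" for j t
  proof -
    have "x t = (\<Sum>i<n. c i * frac_power a (real i) t) + rl_integral a (real N * \<gamma>) g t"
      using caputo_expansion[OF assms(2) _ x that(2)] init \<gamma>(1) assms(4) by (simp add: n_def g_def)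
    \<comment> \<open>Splitting the exponents at j \<gamma> leaves a polynomial plus terms that are
      the order j \<gamma> integral of Y j.\<close>
    also have "{..<n} = {..<nat \<lceil>real j * \<gamma>\<rceil>} \<union> I j"
      using that(1) by (auto simp: I_def n_def ceil)
    also have "(\<Sum>i\<in>\<dots>. c i * frac_power a (real i) t) = (\<Sum>i<nat \<lceil>real j * \<gamma>\<rceil>. c i * frac_power a (real i) t)
        + (\<Sum>i\<in>I j. c i * frac_power a (real i) t)"
      by (rule sum.union_disjoint) (auto simp: I_def ceil)
    also have "real N * \<gamma> = real j * \<gamma> + real (N - j) * \<gamma>"
      using that(1) by (simp add: of_nat_diff algebra_simps)
    finally show ?thesis
      using that \<gamma>(1) by (simp add: rl_Y)
  qed
  have pos: "0 < real j * \<gamma>" if "0 < j" for j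
    using that \<gamma>(1) by simp
  note caputo = cont_caputo_differentiable_if_expansion(1,2)[OF assms(2) pos cont_Y expansion]
  show "cont_caputo_differentiable a b (real j * \<gamma>) x" if "0 < j" "j \<le> N" for j
    using that by (intro caputo(1))
  have deriv_Y: "caputo_deriv a b (real j * \<gamma>) x t = Y j t" if "j \<le> N" "t \<in> {a..b}" for j t
  proof (cases "j = 0")
    case True
    then show ?thesis
      using expansion[of 0 t] that by (simp add: caputo_deriv_def)
  next
    case False
    then show ?thesis
      using that by (intro caputo(2)) auto
  qed
  define d where "d j = (if M dvd j then c (j div M) else 0)" for j
  have step: "Y j t = d j + rl_integral a \<gamma> (Y (Suc j)) t" if "j < N" "t \<in> {a..b}" for j t
  proof -
    \<comment> \<open>Passing from j to j + 1 loses only the exponent i with i M = j, present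
      exactly when M divides j; its lowered power is the constant 1.\<close>
    have I: "I j = (if M dvd j then {j div M} else {}) \<union> I (Suc j)"
      using that(1) assms(3) by (auto simp: I_def n_def ceil Suc_le_eq le_less)
    have "(\<Sum>i\<in>I j. c i * frac_power a (real i - real j * \<gamma>) t)
        = (\<Sum>i\<in>(if M dvd j then {j div M} else {}). c i * frac_power a (real i - real j * \<gamma>) t)
        + (\<Sum>i\<in>I (Suc j). c i * frac_power a (real i - real j * \<gamma>) t)"
      unfolding I by (rule sum.union_disjoint) (auto simp: I_def)
    also have "(\<Sum>i\<in>(if M dvd j then {j div M} else {}). c i * frac_power a (real i - real j * \<gamma>) t) = d j"
      by (simp add: d_def \<gamma>_def real_of_nat_div)
    finally show ?thesis
      using that \<gamma>(1) by (simp add: rl_Y) (simp add: Y_def of_nat_diff algebra_simps)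
  qed
  have "Y j a = d j" if "j < N" for j
    using step[of j a] that assms(2) \<gamma>(1) by (simp add: rl_integral_at_start)
  then show "\<And>j. j < N \<Longrightarrow> caputo_deriv a b (real j * \<gamma>) x a = (if M dvd j then c (j div M) else 0)"
    using deriv_Y assms(2) by (simp add: d_def)
  \<comment> \<open>As \<gamma> has ceiling 1, a constant plus an integral of order \<gamma> is
    already a Caputo expansion of order \<gamma>.\<close>
  have chain: "caputo_deriv a b (real j * \<gamma>) x t = (\<Sum>i<nat \<lceil>\<gamma>\<rceil>. d j * frac_power a (real i) t)
      + rl_integral a \<gamma> (Y (Suc j)) t" if "j < N" "t \<in> {a..b}" for j t
    using that step deriv_Y by (simp add: ceil_1)
  note chain = cont_caputo_differentiable_if_expansion(1,2)[OF assms(2) \<gamma>(1) cont_Y chain]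
  show "cont_caputo_differentiable a b \<gamma> (caputo_deriv a b (real j * \<gamma>) x)" if "j < N" for j
    by (rule chain(1)) (use that in auto)
  show "caputo_deriv a b \<gamma> (caputo_deriv a b (real j * \<gamma>) x) t = caputo_deriv a b (real (Suc j) * \<gamma>) x t"
    if "j < N" "t \<in> {a..b}" for j t
  proof -
    have "caputo_deriv a b \<gamma> (caputo_deriv a b (real j * \<gamma>) x) t = Y (Suc j) t"
      by (rule chain(2)) (use that in auto)
    then show ?thesis
      using deriv_Y[of "Suc j" t] that by simp
  qed
qed

section \<open>Equivalence of the multi-term equation and the system\<close>

theorem theorem13:
  fixes a b :: real
    and k :: nat
    and \<alpha> :: "nat \<Rightarrow> real"
    and f :: "real \<times> (nat \<Rightarrow> real) \<Rightarrow> real"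
    and xa :: "nat \<Rightarrow> real"
    and M N :: nat
    and \<gamma> :: real
  assumes "a < b"
    and "k \<ge> 1"
    and "\<forall>j\<in>{2..k}. \<alpha> (j - 1) < \<alpha> j"
    and "\<forall>j\<in>{2..k}. \<alpha> j - \<alpha> (j - 1) \<le> 1"
    and "0 < \<alpha> 1" and "\<alpha> 1 \<le> 1"
    and "continuous_map (prod_topology (top_of_set {a..b}) (Euclidean_space k)) euclideanreal f"
    and "\<forall>j\<in>{1..k}. \<alpha> j \<in> \<rat>"
  defines "M \<equiv> Lcm (denominator ` \<alpha> ` {1..k})"
    and "\<gamma> \<equiv> 1 / real M"
    and "N \<equiv> nat \<lfloor>real M * \<alpha> k\<rfloor>"
  shows "(\<forall>X. system_solution a b k \<alpha> f \<gamma> N X \<and> system_initial a M N xa X \<longrightarrow>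
            multi_term_solution a b k \<alpha> f (X 0) \<and> multi_term_initial a b k \<alpha> xa (X 0)) \<and>
         (\<forall>x. C_class a b (nat \<lceil>\<alpha> k\<rceil> - 1) x \<and>
            multi_term_solution a b k \<alpha> f x \<and> multi_term_initial a b k \<alpha> xa x \<longrightarrow>
            (\<forall>j<N. caputo_differentiable a b (real j * \<gamma>) x) \<and>
            system_solution a b k \<alpha> f \<gamma> N (\<lambda>j. caputo_deriv a b (real j * \<gamma>) x) \<and>
            system_initial a M N xa (\<lambda>j. caputo_deriv a b (real j * \<gamma>) x))"
proof -
  have \<alpha>_less: "\<alpha> i < \<alpha> j" if "1 \<le> i" "i < j" "j \<le> k" for i j
    using that(2,3)
  proof (induction j)
    case (Suc j)
    have "\<alpha> j < \<alpha> (Suc j)"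
      using bspec[OF assms(3), of "Suc j"] that(1) Suc.prems by simp
    then show ?case
      using Suc by (cases "i = j") auto
  qed simp
  have \<alpha>_pos: "\<alpha> i > 0" if "i \<in> {1..k}" for i
    using \<alpha>_less[of 1 i] that assms(5) by (cases "i = 1") auto
  have exact: "M > 0" "real (nat \<lfloor>real M * \<alpha> i\<rfloor>) = real M * \<alpha> i" if "i \<in> {1..k}" for i
    using nat_floor_Lcm_denominator_mult[of "\<alpha> ` {1..k}" "\<alpha> i"] that assms(8) \<alpha>_pos[OF that]
    by (auto simp: M_def)
  have k: "k \<in> {1..k}"
    using assms(2) by simp
  have M: "M > 0"
    using exact(1)[OF k] .
  \<comment> \<open>The index of the component that stands for the derivative of order \<alpha> i;
    the floor is exact because M clears all denominators.\<close>
  define p where "p i = nat \<lfloor>\<alpha> i / \<gamma>\<rfloor>" for i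
  have p: "real (p i) * \<gamma> = \<alpha> i" "0 < p i" if "i \<in> {1..k}" for i
  proof -
    show "real (p i) * \<gamma> = \<alpha> i"
      using exact(2)[OF that] M by (simp add: p_def \<gamma>_def mult.commute)
    then show "0 < p i"
      using \<alpha>_pos[OF that] by (cases "p i = 0") auto
  qed
  have N: "N = p k"
    by (simp add: N_def p_def \<gamma>_def mult.commute)
  have N_pos: "N > 0" and N_\<gamma>: "real N * \<gamma> = \<alpha> k"
    using p[OF k] by (simp_all add: N)
  have p_less: "p i < N" if "1 \<le> i" "i < k" for i
  proof -
    have "real (p i) * \<gamma> < real N * \<gamma>"
      using \<alpha>_less[OF that] p(1)[of i] that N_\<gamma> by simp
    then show ?thesis
      using M by (simp add: \<gamma>_def divide_less_cancel)
  qed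
  have Nats_iff: "real j / real M \<in> \<nat> \<longleftrightarrow> M dvd j" for j
  proof
    assume "real j / real M \<in> \<nat>"
    then obtain n where "real j / real M = real n"
      by (auto elim: Nats_cases)
    then have "real j = real (M * n)"
      using M by (simp add: field_simps)
    then show "M dvd j"
      by (simp only: of_nat_eq_iff dvd_triv_left)
  qed (use M in \<open>auto elim!: dvdE\<close>)
  have "multi_term_solution a b k \<alpha> f (X 0) \<and> multi_term_initial a b k \<alpha> xa (X 0)"
    if X: "system_solution a b k \<alpha> f \<gamma> N X" "system_initial a M N xa X" for X
  proof -
    \<comment> \<open>The derivative of the last component is appended at index N, so one recursion
      holds for all j < N; the right-hand side f enters only after the chain is unfolded.\<close>
    define Y where "Y j = (if j < N then X j else caputo_deriv a b \<gamma> (X (N - 1)))" for j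
    have diff: "cont_caputo_differentiable a b \<gamma> (Y j)" if "j < N" for j
      using X(1) that by (simp add: system_solution_def Y_def)
    have deriv: "caputo_deriv a b \<gamma> (Y j) t = Y (Suc j) t" if "j < N" "t \<in> {a..b}" for j t
    proof (cases "Suc j < N")
      case True
      then show ?thesis
        using X(1) that by (simp add: system_solution_def Y_def)
    next
      case False
      then have "N - 1 = j"
        using that(1) by simp
      then show ?thesis
        using False that(1) by (simp add: Y_def)
    qed
    have cont: "continuous_on {a..b} (Y N)"
      using diff[of "N - 1"] N_pos by (simp add: Y_def cont_caputo_differentiable_def)
    have init: "Y j a = (if M dvd j then xa (j div M) else 0)" if "j < N" for j
      using X(2) that by (simp add: system_initial_def Y_def Nats_iff)
    have Y_0: "Y 0 = X 0"
      using N_pos by (simp add: Y_def)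
    note caputo = caputo_chain_imp_caputo[where N = N and M = M and Y = Y and c = xa, folded \<gamma>_def,
        OF assms(1) M diff deriv cont init, unfolded Y_0]
    have caputo_X: "cont_caputo_differentiable a b (\<alpha> i) (X 0)"
      "\<And>t. t \<in> {a..b} \<Longrightarrow> caputo_deriv a b (\<alpha> i) (X 0) t = Y (p i) t" if "i \<in> {1..k}" for i
    proof -
      have "p i \<le> N"
        using p_less[of i] that N by (cases "i = k") auto
      then show "cont_caputo_differentiable a b (\<alpha> i) (X 0)"
        "\<And>t. t \<in> {a..b} \<Longrightarrow> caputo_deriv a b (\<alpha> i) (X 0) t = Y (p i) t"
        using caputo(1,2)[of "p i"] p[OF that] by simp_all
    qed
    have "caputo_deriv a b (\<alpha> k) (X 0) t =
        f (t, \<lambda>i. if i = 0 then X 0 t else if i < k then caputo_deriv a b (\<alpha> i) (X 0) t else 0)"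
      if t: "t \<in> {a..b}" for t
    proof -
      \<comment> \<open>Since p i < N for i < k, the chain entry at p i is a genuine component of X,
        and the arguments of f agree.\<close>
      have "X (nat \<lfloor>\<alpha> i / \<gamma>\<rfloor>) t = caputo_deriv a b (\<alpha> i) (X 0) t" if "i \<noteq> 0" "i < k" for i
        using caputo_X(2)[of i, OF _ t] p_less[of i] that by (simp add: Y_def flip: p_def)
      then have "(\<lambda>i. if i = 0 then X 0 t else if i < k then X (nat \<lfloor>\<alpha> i / \<gamma>\<rfloor>) t else 0)
          = (\<lambda>i. if i = 0 then X 0 t else if i < k then caputo_deriv a b (\<alpha> i) (X 0) t else 0)"
        by (simp add: fun_eq_iff)
      moreover have "caputo_deriv a b (\<alpha> k) (X 0) t = caputo_deriv a b \<gamma> (X (N - 1)) t"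
        using caputo_X(2)[OF k t] by (simp add: Y_def flip: N)
      ultimately show ?thesis
        using X(1) t by (simp add: system_solution_def)
    qed
    moreover have "nderiv a b j (X 0) a = xa j" if "j < nat \<lceil>\<alpha> k\<rceil>" for j
      using caputo(3)[of N j] that N_pos N_\<gamma> by simp
    ultimately show ?thesis
      using caputo_X(1) caputo_X(1)[OF k] by (simp add: multi_term_solution_def multi_term_initial_def
          cont_caputo_differentiable_def)
  qed
  moreover have "(\<forall>j<N. caputo_differentiable a b (real j * \<gamma>) x) \<and>
      system_solution a b k \<alpha> f \<gamma> N (\<lambda>j. caputo_deriv a b (real j * \<gamma>) x) \<and>
      system_initial a M N xa (\<lambda>j. caputo_deriv a b (real j * \<gamma>) x)"
    if x: "multi_term_solution a b k \<alpha> f x" "multi_term_initial a b k \<alpha> xa x" for x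
  proof -
    have cont_x: "cont_caputo_differentiable a b (real N * \<gamma>) x"
      using x(1) by (simp add: multi_term_solution_def N_\<gamma>)
    have init: "nderiv a b i x a = xa i" if "i < nat \<lceil>real N * \<gamma>\<rceil>" for i
      using x(2) that by (simp add: multi_term_initial_def N_\<gamma>)
    note chain = caputo_imp_caputo_chain[where N = N and M = M and x = x and c = xa, folded \<gamma>_def,
        OF assms(1) M N_pos cont_x init]
    \<comment> \<open>Order 0 is treated separately: there differentiability holds by definition,
      while \<open>chain(1)\<close> speaks of positive j.\<close>
    have "caputo_differentiable a b (real j * \<gamma>) x" if "j < N" for j
      using chain(1)[of j] that
      by (cases "j = 0") (auto simp: cont_caputo_differentiable_def caputo_differentiable_def)
    moreover have "caputo_deriv a b \<gamma> (caputo_deriv a b (real (N - 1) * \<gamma>) x) t =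
        f (t, \<lambda>i. if i = 0 then caputo_deriv a b (real 0 * \<gamma>) x t
          else if i < k then caputo_deriv a b (real (nat \<lfloor>\<alpha> i / \<gamma>\<rfloor>) * \<gamma>) x t else 0)"
      if t: "t \<in> {a..b}" for t
    proof -
      have "(\<lambda>i. if i = 0 then caputo_deriv a b (real 0 * \<gamma>) x t
          else if i < k then caputo_deriv a b (real (nat \<lfloor>\<alpha> i / \<gamma>\<rfloor>) * \<gamma>) x t else 0)
          = (\<lambda>i. if i = 0 then x t else if i < k then caputo_deriv a b (\<alpha> i) x t else 0)"
        using p(1) by (simp add: fun_eq_iff caputo_deriv_def[of a b 0] flip: p_def)
      \<comment> \<open>The last link of the chain reaches order N \<gamma> = \<alpha> k, so the
        last equation of the system is the original equation.\<close>
      moreover have "caputo_deriv a b \<gamma> (caputo_deriv a b (real (N - 1) * \<gamma>) x) t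
          = caputo_deriv a b (\<alpha> k) x t"
        using chain(3)[of "N - 1" t] N_pos t by (simp add: N_\<gamma> del: of_nat_Suc)
      ultimately show ?thesis
        using x(1) t by (simp only: multi_term_solution_def)
    qed
    ultimately show ?thesis
      using chain(2,3,4) by (auto simp: system_solution_def system_initial_def Nats_iff)
  qed
  ultimately show ?thesis
    by blast
qed

end
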